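(* Let $PG_n$ be the random pentagonal chain network described in the context, and assume Hypotheses 1 and 2 of the context hold. Then: (i) For $n\ge 1$, $$Var\big(S(PG_{n})\big)=\frac{1}{30}\Big(\sigma^{2}_{2}n^{5}-5r_{2}n^{4}+10\tilde{\sigma}^{2}_{2}n^{3}+(65r_{2}-30\sigma^{2}_{2}-45\tilde{\sigma}^{2}_{2})n^{2}+(59\sigma^{2}_{2}+65\tilde{\sigma}^{2}_{2}-120r_{2})n+(60r_{2}-30\sigma^{2}_{2}-30\tilde{\sigma}^{2}_{2})\Big),$$ where $\sigma^{2}_{2}=240^{2}p_{1}+360^{2}(1-p_{1})-\big(240p_{1}+360(1-p_{1})\big)^{2}$, $\tilde{\sigma}^{2}_{2}=113^{2}p_{1}+233^{2}(1-p_{1})-\big(113p_{1}+233(1-p_{1})\big)^{2}$, $r_{2}=240\cdot113\,p_{1}+360\cdot233\,(1-p_{1})-\big(240p_{1}+360(1-p_{1})\big)\big(113p_{1}+233(1-p_{1})\big)$. (ii) $S(PG_n)$ is asymptotically normal: $$\lim_{n\rightarrow \infty}\sup_{a\in \mathbb{R}}\Big| \mathbb{P}\Big(\frac{S(PG_{n})-\mathbb{E}\big(S(PG_{n})\big)}{\sqrt{Var\big(S(PG_{n})\big)}}\leq a\Big)-\int^{a}_{-\infty}\frac{1}{\sqrt{2\pi}}e^{-t^{2}/2}\,dt \Big| =0.$$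
   Context: Random chain network $PG_n$: $PG_1$ is a $5$-cycle (pentagon). For $n\ge 1$, $PG_{n+1}$ is obtained from $PG_n$ by adding a new pentagon $O_{n+1}$ with vertices $x_1,\dots,x_5$ in cyclic order and adding one edge joining $x_1$ to a vertex $u_n$ of $PG_n$. The vertex $u_1$ is any vertex of $PG_1$. For $n\ge 2$, $u_n$ is a vertex of the last pentagon $O_n$ (whose vertex $x_1$ is the one joined to $u_{n-1}$): either $u_n\in\{x_2,x_5\}$ of $O_n$ (neighbours of $x_1$ in $O_n$; set $Z_n^1=1$, $Z_n^2=0$) or $u_n\in\{x_3,x_4\}$ of $O_n$ (vertices at distance $2$ from $x_1$ in $O_n$; set $Z_n^1=0$, $Z_n^2=1$), with $\mathbb{P}(Z_n^1=1)=p_1$, $\mathbb{P}(Z_n^2=1)=p_2=1-p_1$, constants independent of $n$. Hypothesis 1: the random vectors $(Z_n^1,Z_n^2)$, $n=2,3,\dots$, are independent. Hypothesis 2: $0<p_i<1$ for $i=1,2$. For a graph $G$, $d(v)$ is the degree of $v$, $d(u,v)$ the shortest-path distance, and the Schultz index is $S(G)=\sum_{\{u,v\}\subseteq V_G} \big(d(u)+d(v)\big)\,d(u,v)$ over unordered pairs of distinct vertices. *)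

theory Defs
  imports "HOL-Probability.Probability"
begin

definition gdeg :: "'v set \<Rightarrow> ('v \<Rightarrow> 'v \<Rightarrow> bool) \<Rightarrow> 'v \<Rightarrow> nat" where
  "gdeg V adj u = card {v \<in> V. adj u v}"

definition gdist :: "('v \<Rightarrow> 'v \<Rightarrow> bool) \<Rightarrow> 'v \<Rightarrow> 'v \<Rightarrow> nat" where
  "gdist adj u v = (LEAST k. (u, v) \<in> {(x, y). adj x y} ^^ k)"

text \<open>Schultz index: sum over unordered pairs of distinct vertices of
  (d(u)+d(v)) d(u,v); written as half the sum over ordered pairs
  (diagonal terms vanish since d(u,u)=0).\<close>
definition schultz :: "'v set \<Rightarrow> ('v \<Rightarrow> 'v \<Rightarrow> bool) \<Rightarrow> nat" where
  "schultz V adj =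
     (\<Sum>u\<in>V. \<Sum>v\<in>V. (gdeg V adj u + gdeg V adj v) * gdist adj u v) div 2"

text \<open>Vertex (i,j): vertex x_{j+1} of the i-th pentagon O_i, i = 1..n, j = 0..4
  (cyclic order, j = 0 is x_1). The sequence c gives the attachment vertices:
  u_i = (i, c i), joined to x_1 = (i+1, 0) of O_{i+1}, for i = 1..n-1.\<close>
definition pg_verts :: "nat \<Rightarrow> (nat \<times> nat) set" where
  "pg_verts n = {1..n} \<times> {0..<5}"

definition pg_adj0 :: "(nat \<Rightarrow> nat) \<Rightarrow> nat \<Rightarrow> nat \<times> nat \<Rightarrow> nat \<times> nat \<Rightarrow> bool" where
  "pg_adj0 c n u v \<longleftrightarrow>
     (fst u = fst v \<and> snd v = (snd u + 1) mod 5) \<or>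
     (fst v = fst u + 1 \<and> snd v = 0 \<and> snd u = c (fst u))"

definition pg_adj :: "(nat \<Rightarrow> nat) \<Rightarrow> nat \<Rightarrow> nat \<times> nat \<Rightarrow> nat \<times> nat \<Rightarrow> bool" where
  "pg_adj c n u v \<longleftrightarrow> u \<in> pg_verts n \<and> v \<in> pg_verts n \<and>
     (pg_adj0 c n u v \<or> pg_adj0 c n v u)"

definition pg_schultz :: "nat \<Rightarrow> (nat \<Rightarrow> nat) \<Rightarrow> nat" where
  "pg_schultz n c = schultz (pg_verts n) (pg_adj c n)"

end

theory Submission
  imports Defs "HOL-Real_Asymp.Real_Asymp"
begin

text \<open>
  Distances in the chain split along the bridges, so the attachment vertex of the \<open>k\<close>-th pentagon
  enters only through its distance \<open>d\<^sub>k \<in> {1, 2}\<close> from \<open>x\<^sub>1\<close>. Summing over pairs of pentagons,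
  the contributions of the degree-3 vertices cancel against the boundary terms at the first and last
  pentagon, and the Schultz index becomes
  \<open>20n\<^sup>3 + 127n\<^sup>2 - 87n + 120 \<Sum>\<^sub>k (k - 1)(n - k) d\<^sub>k\<close>.
  It is thus an affine function of independent two-valued variables. The variance is
  \<open>14400 p\<^sub>1(1 - p\<^sub>1) \<Sum>\<^sub>k (k - 1)\<^sup>2(n - k)\<^sup>2\<close>, of order \<open>n\<^sup>5\<close>, while each weight is only of order
  \<open>n\<^sup>2\<close>; so the standardised summands are uniformly small and a Lindeberg-type central limit theorem
  applies. Since the normal distribution function is continuous, the convergence is uniform.
\<close>

section \<open>Distances and degrees in the pentagonal chain\<close>

text \<open>The case split keeps subtraction on the naturals from truncating.\<close>

definition cyc_dist :: "nat \<Rightarrow> nat \<Rightarrow> nat" where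
  "cyc_dist a b = (if a \<le> b then min (b - a) (5 - (b - a)) else min (a - b) (5 - (a - b)))"

text \<open>The distance between \<open>u\<^sub>i\<close> and the vertex \<open>x\<^sub>1\<close> of the \<open>j\<close>-th pentagon, for \<open>i < j\<close>.\<close>

definition gap :: "(nat \<Rightarrow> nat) \<Rightarrow> nat \<Rightarrow> nat \<Rightarrow> nat" where
  "gap c i j = 1 + (\<Sum>k\<in>{i<..<j}. cyc_dist 0 (c k) + 1)"

text \<open>Length of the route that the bridges force: from \<open>u\<close> to the attachment
  vertex of its pentagon, across to \<open>x_1\<close> of the pentagon of \<open>v\<close>, then on
  to \<open>v\<close>. Meaningful only for \<open>fst u < fst v\<close>.\<close>

definition link :: "(nat \<Rightarrow> nat) \<Rightarrow> nat \<times> nat \<Rightarrow> nat \<times> nat \<Rightarrow> nat" where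
  "link c u v = cyc_dist (snd u) (c (fst u)) + gap c (fst u) (fst v) + cyc_dist 0 (snd v)"

definition chain_dist :: "(nat \<Rightarrow> nat) \<Rightarrow> nat \<times> nat \<Rightarrow> nat \<times> nat \<Rightarrow> nat" where
  "chain_dist c u v =
     (if fst u = fst v then cyc_dist (snd u) (snd v)
      else if fst u < fst v then link c u v else link c v u)"

section \<open>Cyclic distance and the recursions for gaps\<close>

lemma less5_cases: "(a::nat) < 5 \<longleftrightarrow> a = 0 \<or> a = 1 \<or> a = 2 \<or> a = 3 \<or> a = 4"
  by auto

lemma cyc_dist_commute: "cyc_dist a b = cyc_dist b a"
  by (auto simp: cyc_dist_def)

lemma cyc_dist_self [simp]: "cyc_dist a a = 0"
  by (simp add: cyc_dist_def)

lemma cyc_dist_step: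
  assumes "a < 5" "b < 5"
  shows "cyc_dist a ((b + 1) mod 5) \<le> cyc_dist a b + 1"
    and "cyc_dist a b \<le> cyc_dist a ((b + 1) mod 5) + 1"
  using assms unfolding less5_cases by (auto simp: cyc_dist_def)

lemma sum_lessThan_5: "(\<Sum>a\<in>{0..<5::nat}. f a) = f 0 + f 1 + f 2 + f 3 + (f 4 :: 'a::comm_monoid_add)"
  by (simp add: eval_nat_numeral add.assoc)

lemma gap_Suc [simp]: "gap c i (Suc i) = 1"
  by (simp add: gap_def greaterThanLessThan_eq flip: atLeastSucLessThan_greaterThanLessThan)

lemma gap_extend_right: "i < j \<Longrightarrow> gap c i (Suc j) = gap c i j + cyc_dist 0 (c j) + 1"
  by (simp add: gap_def flip: atLeastSucLessThan_greaterThanLessThan)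

lemma gap_extend_left: "Suc i < j \<Longrightarrow> gap c i j = gap c (Suc i) j + cyc_dist 0 (c (Suc i)) + 1"
  by (simp add: gap_def sum.atLeast_Suc_lessThan flip: atLeastSucLessThan_greaterThanLessThan)

text \<open>A potential that vanishes at \<open>u\<close> and grows by at most 1 along each edge
  bounds the length of every walk from \<open>u\<close> from below; the given walk attains this
  bound.\<close>

lemma gdist_eqI:
  assumes walk: "(u, v) \<in> {(x, y). adj x y} ^^ f v"
    and f0: "f u = 0" and step: "\<And>x y. adj x y \<Longrightarrow> f y \<le> f x + (1::nat)"
  shows "gdist adj u v = f v"
proof -
  have "f w \<le> k" if "(u, w) \<in> {(x, y). adj x y} ^^ k" for k w
    using that
  proof (induction k arbitrary: w)
    case 0
    then show ?case using f0 by auto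
  next
    case (Suc k)
    then obtain x where "(u, x) \<in> {(x, y). adj x y} ^^ k" "adj x w"
      by auto
    with Suc.IH[of x] step[of x w] show ?case by simp
  qed
  with walk show ?thesis
    unfolding gdist_def by (intro Least_equality) auto
qed

section \<open>The chain distance as a potential\<close>

lemma pg_adj_commute: "pg_adj c n u v \<longleftrightarrow> pg_adj c n v u"
  by (auto simp: pg_adj_def)

lemma chain_dist_commute: "chain_dist c u v = chain_dist c v u"
  by (auto simp: chain_dist_def cyc_dist_commute)

text \<open>Both inequalities are proved for the oriented relation \<open>pg_adj0\<close>, so that
  either orientation of an edge of \<open>pg_adj\<close> is covered. Edges inside a pentagon reduce
  to \<open>cyc_dist_step\<close>.\<close>

lemma chain_dist_step0:
  assumes c: "\<And>i. 1 \<le> i \<Longrightarrow> i < n \<Longrightarrow> c i < 5"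
    and "u \<in> pg_verts n" "v \<in> pg_verts n" "w \<in> pg_verts n" "pg_adj0 c n v w"
  shows "chain_dist c u v \<le> chain_dist c u w + 1 \<and> chain_dist c u w \<le> chain_dist c u v + 1"
proof -
  obtain i a j b k d where u: "u = (i, a)" and v: "v = (j, b)" and w: "w = (k, d)"
    by (metis surj_pair)
  have lt: "a < 5" "b < 5" "d < 5" and i: "1 \<le> i" "i \<le> n" "1 \<le> j" "j \<le> n" "1 \<le> k" "k \<le> n"
    using assms u v w by (auto simp: pg_verts_def)
  from assms(5) v w consider "k = j" "d = (b + 1) mod 5" | "k = Suc j" "d = 0" "b = c j"
    by (auto simp: pg_adj0_def)
  then show ?thesis
  proof cases
    case 1
    \<comment> \<open>If \<open>u\<close> lies in a later pentagon, the route leaves pentagon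
      \<open>j\<close> through \<open>c j\<close>; the bound on \<open>c j\<close> is available
      since \<open>j < i \<le> n\<close>.\<close>
    have "j < i \<Longrightarrow> c j < 5"
      using c i by simp
    with 1 show ?thesis
      using cyc_dist_step[of a b] cyc_dist_step[of 0 b] cyc_dist_step[of "c j" b] lt
      by (auto simp: u v w chain_dist_def link_def cyc_dist_commute[of b "c j"]
          cyc_dist_commute[of "Suc b mod 5" "c j"])
  next
    case 2
    \<comment> \<open>Crossing a bridge changes the distance by exactly 1; the recursions for
      \<open>gap\<close> show this when \<open>u\<close> is not in either of the two pentagons
      joined.\<close>
    consider "i < j" | "i = j" | "i = Suc j" | "Suc j < i"
      by linarith
    then show ?thesis
      using gap_extend_right[of i j c] gap_extend_left[of j i c]
      by cases (auto simp: u v w chain_dist_def link_def 2 cyc_dist_commute[of a 0])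
  qed
qed

lemma chain_dist_step:
  assumes c: "\<And>i. 1 \<le> i \<Longrightarrow> i < n \<Longrightarrow> c i < 5"
    and u: "u \<in> pg_verts n" and adj: "pg_adj c n v w"
  shows "chain_dist c u w \<le> chain_dist c u v + 1"
  using chain_dist_step0[of n c u v w] chain_dist_step0[of n c u w v] c u adj
  by (auto simp: pg_adj_def)

section \<open>Walks that realise the chain distance\<close>

lemma cyc_dist_cases:
  assumes "a < 5" "b < 5"
  obtains "cyc_dist a b = 0" "a = b"
    | "cyc_dist a b = 1" "b = (a + 1) mod 5 \<or> a = (b + 1) mod 5"
    | "cyc_dist a b = 2" "b = ((a + 1) mod 5 + 1) mod 5 \<or> a = ((b + 1) mod 5 + 1) mod 5"
  using assms unfolding less5_cases by (elim disjE) (simp_all add: cyc_dist_def)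

lemma cyc_walk:
  assumes i: "1 \<le> i" "i \<le> n" and a: "a < 5" "b < 5"
  shows "((i, a), (i, b)) \<in> {(x, y). pg_adj c n x y} ^^ cyc_dist a b"
proof -
  have adj: "pg_adj c n (i, x) (i, y)"
    if "x < 5" "y < 5" "y = (x + 1) mod 5 \<or> x = (y + 1) mod 5" for x y
    using that i by (auto simp: pg_adj_def pg_adj0_def pg_verts_def)
  from a show ?thesis
  proof (cases rule: cyc_dist_cases)
    case 1
    then show ?thesis by simp
  next
    case 2
    with adj[of a b] a show ?thesis by simp
  next
    case 3
    \<comment> \<open>The common neighbour follows \<open>a\<close> or follows \<open>b\<close> in
      cyclic order, depending on the direction of the shorter arc.\<close>
    then obtain d where "pg_adj c n (i, a) (i, d)" "pg_adj c n (i, d) (i, b)"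
      using adj[of a "(a + 1) mod 5"] adj[of "(a + 1) mod 5" b]
        adj[of a "(b + 1) mod 5"] adj[of "(b + 1) mod 5" b] a by auto
    with 3 show ?thesis
      by (auto simp: numeral_2_eq_2)
  qed
qed

lemma relpow_transI: "(x, y) \<in> R ^^ k \<Longrightarrow> (y, z) \<in> R ^^ l \<Longrightarrow> (x, z) \<in> R ^^ (k + l)"
  by (auto simp: relpow_add)

lemma gap_walk:
  assumes c: "\<And>i. 1 \<le> i \<Longrightarrow> i < n \<Longrightarrow> c i < 5"
    and "1 \<le> i" "i < j" "j \<le> n"
  shows "((i, c i), (j, 0)) \<in> {(x, y). pg_adj c n x y} ^^ gap c i j"
  using \<open>i < j\<close> \<open>j \<le> n\<close>
proof (induction j)
  case (Suc j)
  have bridge: "pg_adj c n (j, c j) (Suc j, 0)" if "1 \<le> j"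
    using that Suc.prems c[of j] by (auto simp: pg_adj_def pg_adj0_def pg_verts_def)
  show ?case
  proof (cases "i = j")
    case True
    with bridge \<open>1 \<le> i\<close> show ?thesis by simp
  next
    case False
    with Suc.prems have "i < j" by simp
    have "((i, c i), (Suc j, 0)) \<in> {(x, y). pg_adj c n x y} ^^ (gap c i j + cyc_dist 0 (c j) + 1)"
      using Suc \<open>i < j\<close> \<open>1 \<le> i\<close> c[of j] bridge
      by (intro relpow_transI[where y = "(j, c j)"] relpow_transI[where y = "(j, 0)"] cyc_walk) auto
    with \<open>i < j\<close> show ?thesis by (simp add: gap_extend_right)
  qed
qed simp

lemma link_walk:
  assumes c: "\<And>i. 1 \<le> i \<Longrightarrow> i < n \<Longrightarrow> c i < 5"
    and u: "u \<in> pg_verts n" and v: "v \<in> pg_verts n" and less: "fst u < fst v"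
  shows "(u, v) \<in> {(x, y). pg_adj c n x y} ^^ link c u v"
proof -
  obtain i a j b where uv: "u = (i, a)" "v = (j, b)"
    by (metis surj_pair)
  from u v less have "1 \<le> i" "i < j" "j \<le> n" "a < 5" "b < 5"
    by (auto simp: uv pg_verts_def)
  with c[of i] show ?thesis
    unfolding uv link_def fst_conv snd_conv
    by (intro relpow_transI[where y = "(j, 0)"] relpow_transI[where y = "(i, c i)"]
        gap_walk cyc_walk c) auto
qed

lemma gdist_sym:
  assumes "\<And>x y. adj x y \<longleftrightarrow> adj y x"
  shows "gdist adj u v = gdist adj v u"
proof -
  have "(x, y) \<in> {(x, y). adj x y} ^^ k" if "(y, x) \<in> {(x, y). adj x y} ^^ k" for x y k
    using that
  proof (induction k arbitrary: x)
    case (Suc k)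
    then obtain z where "(y, z) \<in> {(x, y). adj x y} ^^ k" "adj z x"
      by auto
    with Suc.IH[of z] assms show ?case
      by (intro relpow_Suc_I2) auto
  qed auto
  then have "(u, v) \<in> {(x, y). adj x y} ^^ k \<longleftrightarrow> (v, u) \<in> {(x, y). adj x y} ^^ k" for k
    by blast
  then show ?thesis
    unfolding gdist_def by simp
qed

lemma gdist_pg_adj:
  assumes c: "\<And>i. 1 \<le> i \<Longrightarrow> i < n \<Longrightarrow> c i < 5"
    and u: "u \<in> pg_verts n" and v: "v \<in> pg_verts n"
  shows "gdist (pg_adj c n) u v = chain_dist c u v"
proof -
  \<comment> \<open>Explicit walks were built only towards later pentagons; symmetry of both
    distances gives the other direction.\<close>
  have *: "gdist (pg_adj c n) u v = chain_dist c u v"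
    if "fst u \<le> fst v" "u \<in> pg_verts n" "v \<in> pg_verts n" for u v
  proof (rule gdist_eqI)
    show "chain_dist c u u = 0"
      by (simp add: chain_dist_def)
    show "chain_dist c u y \<le> chain_dist c u x + 1" if "pg_adj c n x y" for x y
      using c \<open>u \<in> pg_verts n\<close> that by (rule chain_dist_step)
    show "(u, v) \<in> {(x, y). pg_adj c n x y} ^^ chain_dist c u v"
    proof (cases "fst u = fst v")
      case True
      with that cyc_walk[of "fst u" n "snd u" "snd v" c] show ?thesis
        by (cases u; cases v) (auto simp: chain_dist_def pg_verts_def)
    next
      case False
      with that link_walk[of n c u v] c show ?thesis
        by (auto simp: chain_dist_def)
    qed
  qed
  show ?thesis
  proof (cases "fst u \<le> fst v")
    case True
    then show ?thesis using * u v by simp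
  next
    case False
    then show ?thesis
      using *[of v u] u v gdist_sym[of "pg_adj c n" u v] pg_adj_commute
      by (metis chain_dist_commute nat_le_linear)
  qed
qed

section \<open>Vertex degrees\<close>

definition pg_deg :: "(nat \<Rightarrow> nat) \<Rightarrow> nat \<Rightarrow> nat \<Rightarrow> nat \<Rightarrow> nat" where
  "pg_deg c n i a = 2 + of_bool (i < n \<and> a = c i) + of_bool (1 < i \<and> a = 0)"

text \<open>The neighbourhood is listed explicitly: two cyclic neighbours, at most one vertex
  \<open>R\<close> across the outgoing bridge and at most one vertex \<open>L\<close> across the
  incoming one. A vertex that carries both bridges gets degree 4, in line with the additive form of
  \<open>pg_deg\<close>.\<close>

lemma gdeg_pg_adj:
  assumes c: "\<And>i. 1 \<le> i \<Longrightarrow> i < n \<Longrightarrow> c i < 5"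
    and i: "1 \<le> i" "i \<le> n" and a: "a < 5"
  shows "gdeg (pg_verts n) (pg_adj c n) (i, a) = pg_deg c n i a"
proof -
  define R where "R = (if i < n \<and> a = c i then {(i + 1, 0::nat)} else {})"
  define L where "L = (if 1 < i \<and> a = 0 then {(i - 1, c (i - 1))} else {})"
  \<comment> \<open>Adding 4 modulo 5 gives the cyclic predecessor without truncated
    subtraction.\<close>
  define s t where "s = (a + 1) mod 5" and "t = (a + 4) mod 5"
  have st: "s < 5" "t < 5" "s \<noteq> t"
    unfolding s_def t_def using a by presburger+
  have cyc: "a = (b + 1) mod 5 \<longleftrightarrow> b = t" if "b < 5" for b
    using that a unfolding t_def less5_cases by (elim disjE) simp_all
  have mem: "v \<in> pg_verts n \<and> pg_adj c n (i, a) v \<longleftrightarrow> v \<in> {(i, s), (i, t)} \<union> (R \<union> L)" for v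
  proof -
    obtain j b where v: "v = (j, b)"
      by (cases v)
    have "v \<in> pg_verts n \<and> pg_adj c n (i, a) v \<longleftrightarrow> 1 \<le> j \<and> j \<le> n \<and> b < 5 \<and>
        (j = i \<and> (b = s \<or> b = t) \<or> j = i + 1 \<and> b = 0 \<and> a = c i \<or> i = j + 1 \<and> a = 0 \<and> b = c j)"
      using i a cyc[of b] unfolding v s_def[symmetric]
      by (auto simp: pg_adj_def pg_adj0_def pg_verts_def s_def[symmetric, simplified])
    also have "\<dots> \<longleftrightarrow> v \<in> {(i, s), (i, t)} \<or> v \<in> R \<or> v \<in> L"
    proof -
      have "1 \<le> j \<and> j \<le> n \<and> b < 5 \<and> j = i \<and> (b = s \<or> b = t) \<longleftrightarrow> v \<in> {(i, s), (i, t)}"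
        using i st unfolding v by blast
      moreover have "1 \<le> j \<and> j \<le> n \<and> b < 5 \<and> j = i + 1 \<and> b = 0 \<and> a = c i \<longleftrightarrow> v \<in> R"
        unfolding v R_def by auto
      moreover have "1 \<le> j \<and> j \<le> n \<and> b < 5 \<and> i = j + 1 \<and> a = 0 \<and> b = c j \<longleftrightarrow> v \<in> L"
        using i c[of j] unfolding v L_def by (cases "i = j + 1") auto
      ultimately show ?thesis by blast
    qed
    finally show ?thesis by simp
  qed
  have "gdeg (pg_verts n) (pg_adj c n) (i, a) = card ({(i, s), (i, t)} \<union> (R \<union> L))"
    unfolding gdeg_def by (intro arg_cong[where f = card] set_eqI) (use mem in blast)
  also have "\<dots> = pg_deg c n i a"
    using st by (auto simp: pg_deg_def R_def L_def card_insert_if)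
  finally show ?thesis .
qed

section \<open>The Schultz index as an affine function of the attachment distances\<close>

lemma sum_cyc_dist:
  assumes "b < 5"
  shows "(\<Sum>a\<in>{0..<5}. cyc_dist a b) = 6" "(\<Sum>a\<in>{0..<5}. cyc_dist b a) = 6"
  using assms unfolding less5_cases sum_lessThan_5
  by (elim disjE; simp add: cyc_dist_def)+

lemma sum_pg_deg_mult:
  assumes "i < n \<Longrightarrow> c i < 5"
  shows "(\<Sum>a\<in>{0..<5}. pg_deg c n i a * f a)
       = 2 * (\<Sum>a\<in>{0..<5}. f a) + of_bool (i < n) * f (c i) + of_bool (1 < i) * f 0"
proof -
  have "(\<Sum>a\<in>{0..<5}. pg_deg c n i a * f a)
      = (\<Sum>a\<in>{0..<5}. 2 * f a) + (\<Sum>a\<in>{0..<5}. if a = c i then of_bool (i < n) * f a else 0)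
        + (\<Sum>a\<in>{0..<5}. if a = 0 then of_bool (1 < i) * f a else 0)"
    unfolding sum.distrib[symmetric]
    by (intro sum.cong) (auto simp: pg_deg_def algebra_simps)
  with assms show ?thesis
    by (auto simp: sum_distrib_left)
qed

lemma sum_pg_deg:
  assumes "i < n \<Longrightarrow> c i < 5"
  shows "(\<Sum>a\<in>{0..<5}. pg_deg c n i a) = 10 + of_bool (i < n) + of_bool (1 < i)"
  using sum_pg_deg_mult[of i n c "\<lambda>_. 1", OF assms] by simp

text \<open>The double sum over vertices is cut into 5 by 5 blocks of ordered pairs, one for each
  pair of pentagons.\<close>

definition block :: "(nat \<Rightarrow> nat) \<Rightarrow> nat \<Rightarrow> nat \<Rightarrow> nat \<Rightarrow> nat" where
  "block c n i j = (\<Sum>a\<in>{0..<5}. \<Sum>b\<in>{0..<5}.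
     (pg_deg c n i a + pg_deg c n j b) * chain_dist c (i, a) (j, b))"

lemma block_commute: "block c n i j = block c n j i"
  unfolding block_def
  by (subst sum.swap) (simp add: chain_dist_commute[of c "(j, _)"] add.commute)

lemma block_same:
  assumes "i < n \<Longrightarrow> c i < 5"
  shows "block c n i i = 2 * (6 * (10 + of_bool (i < n) + of_bool (1 < i)))"
proof -
  have "block c n i i = (\<Sum>a\<in>{0..<5}. \<Sum>b\<in>{0..<5}. pg_deg c n i a * cyc_dist a b)
      + (\<Sum>a\<in>{0..<5}. \<Sum>b\<in>{0..<5}. pg_deg c n i b * cyc_dist a b)"
    by (simp add: block_def chain_dist_def sum.distrib algebra_simps)
  also have "(\<Sum>a\<in>{0..<5}. \<Sum>b\<in>{0..<5}. pg_deg c n i b * cyc_dist a b)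
      = (\<Sum>a\<in>{0..<5}. \<Sum>b\<in>{0..<5}. pg_deg c n i a * cyc_dist a b)"
    by (subst sum.swap) (simp add: cyc_dist_commute)
  also have "(\<Sum>a\<in>{0..<5}. \<Sum>b\<in>{0..<5}. pg_deg c n i a * cyc_dist a b)
      = 6 * (\<Sum>a\<in>{0..<5}. pg_deg c n i a)"
    by (simp add: sum_cyc_dist flip: sum_distrib_left sum_distrib_right)
  finally show ?thesis
    using sum_pg_deg[of i n c] assms by simp
qed

text \<open>Between different pentagons the distance has the separated form
  \<open>p a + g + q b\<close>, so the double sum reduces to products of single sums.\<close>

lemma sum_add_mult_add:
  fixes e f p q :: "nat \<Rightarrow> nat"
  shows "(\<Sum>a\<in>{0..<5}. \<Sum>b\<in>{0..<5}. (e a + f b) * (p a + g + q b))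
    = 5 * (\<Sum>a\<in>{0..<5}. e a * p a) + 5 * (\<Sum>b\<in>{0..<5}. f b * q b)
      + (\<Sum>a\<in>{0..<5}. e a) * (5 * g + (\<Sum>b\<in>{0..<5}. q b))
      + (\<Sum>b\<in>{0..<5}. f b) * (5 * g + (\<Sum>a\<in>{0..<5}. p a))"
  unfolding sum_lessThan_5 by (simp add: algebra_simps)

lemma block_less:
  assumes c: "\<And>i. 1 \<le> i \<Longrightarrow> i < n \<Longrightarrow> c i < 5" and ij: "1 \<le> i" "i < j" "j \<le> n"
  shows "block c n i j = 252 + 110 * gap c i j
    + of_bool (1 < i) * (6 + 5 * gap c i j + 5 * cyc_dist 0 (c i))
    + of_bool (j < n) * (6 + 5 * gap c i j + 5 * cyc_dist 0 (c j))"
proof -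
  have ci: "c i < 5" and cj: "j < n \<Longrightarrow> c j < 5"
    using c ij by auto
  have "block c n i j = (\<Sum>a\<in>{0..<5}. \<Sum>b\<in>{0..<5}. (pg_deg c n i a + pg_deg c n j b)
      * (cyc_dist a (c i) + gap c i j + cyc_dist 0 b))"
    using ij by (simp add: block_def chain_dist_def link_def)
  \<comment> \<open>Here 12 is twice the distance sum 0+1+1+2+2, and 11 is the degree sum 10 of the
    cycle plus the bridge end that must exist: outgoing for \<open>i\<close>, incoming for
    \<open>j\<close>. These ends sit at distance 0 from the route and add nothing to the 12.\<close>
  also have "\<dots> = 5 * (12 + of_bool (1 < i) * cyc_dist 0 (c i))
      + 5 * (12 + of_bool (j < n) * cyc_dist 0 (c j))
      + (11 + of_bool (1 < i)) * (5 * gap c i j + 6) + (11 + of_bool (j < n)) * (5 * gap c i j + 6)"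
    unfolding sum_add_mult_add
    using ij ci sum_pg_deg_mult[of i n c "\<lambda>a. cyc_dist a (c i)"]
      sum_pg_deg_mult[of j n c "cyc_dist 0", OF cj] sum_pg_deg[of i n c] sum_pg_deg[of j n c, OF cj]
      sum_cyc_dist(1)[of "c i"] sum_cyc_dist(2)[of 0]
    by simp
  finally show ?thesis
    by (simp add: algebra_simps)
qed

section \<open>From vertex pairs to pairs of pentagons\<close>

lemma sum_sum_symmetric:
  fixes f :: "nat \<Rightarrow> nat \<Rightarrow> nat"
  assumes sym: "\<And>i j. f i j = f j i"
  shows "(\<Sum>i=1..n. \<Sum>j=1..n. f i j) = (\<Sum>i=1..n. f i i) + 2 * (\<Sum>j=1..n. \<Sum>i=1..<j. f i j)"
proof (induction n)
  case (Suc n)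
  have "(\<Sum>i=1..Suc n. \<Sum>j=1..Suc n. f i j)
      = (\<Sum>i=1..n. \<Sum>j=1..n. f i j) + (\<Sum>i=1..n. f i (Suc n)) + (\<Sum>j=1..n. f (Suc n) j)
        + f (Suc n) (Suc n)"
    by (simp add: sum.distrib)
  also have "(\<Sum>j=1..n. f (Suc n) j) = (\<Sum>i=1..n. f i (Suc n))"
    by (intro sum.cong sym refl)
  finally show ?case
    using Suc by (simp add: atLeastLessThanSuc_atLeastAtMost)
qed simp

text \<open>Diagonal blocks are even and the others pair up by symmetry, so the \<open>div 2\<close>
  in \<open>schultz\<close> is exact.\<close>

lemma pg_schultz_eq_blocks:
  assumes c: "\<And>i. 1 \<le> i \<Longrightarrow> i < n \<Longrightarrow> c i < 5"
  shows "pg_schultz n c = (\<Sum>i=1..n. 6 * (10 + of_bool (i < n) + of_bool (1 < i)))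
    + (\<Sum>j=1..n. \<Sum>i=1..<j. block c n i j)"
proof -
  have prod: "(\<Sum>u\<in>pg_verts n. f u) = (\<Sum>i=1..n. \<Sum>a\<in>{0..<5}. f (i, a))"
    for f :: "nat \<times> nat \<Rightarrow> nat"
    by (simp add: pg_verts_def sum.cartesian_product)
  have deg: "gdeg (pg_verts n) (pg_adj c n) u = pg_deg c n (fst u) (snd u)" if "u \<in> pg_verts n" for u
    using gdeg_pg_adj[of n c "fst u" "snd u"] c that by (auto simp: pg_verts_def)
  have "(\<Sum>u\<in>pg_verts n. \<Sum>v\<in>pg_verts n. (gdeg (pg_verts n) (pg_adj c n) u
        + gdeg (pg_verts n) (pg_adj c n) v) * gdist (pg_adj c n) u v)
      = (\<Sum>u\<in>pg_verts n. \<Sum>v\<in>pg_verts n. (pg_deg c n (fst u) (snd u)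
        + pg_deg c n (fst v) (snd v)) * chain_dist c u v)"
    using c by (intro sum.cong arg_cong2[where f = "(*)"] arg_cong2[where f = "(+)"] refl
        gdist_pg_adj deg) auto
  also have "\<dots> = (\<Sum>i=1..n. \<Sum>a\<in>{0..<5}. \<Sum>j=1..n. \<Sum>b\<in>{0..<5}.
      (pg_deg c n i a + pg_deg c n j b) * chain_dist c (i, a) (j, b))"
    by (simp only: prod fst_conv snd_conv)
  also have "\<dots> = (\<Sum>i=1..n. \<Sum>j=1..n. block c n i j)"
    unfolding block_def by (rule sum.cong[OF refl], rule sum.swap)
  also have "\<dots> = (\<Sum>i=1..n. block c n i i) + 2 * (\<Sum>j=1..n. \<Sum>i=1..<j. block c n i j)"
    by (rule sum_sum_symmetric) (rule block_commute)
  also have "(\<Sum>i=1..n. block c n i i)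
      = 2 * (\<Sum>i=1..n. 6 * (10 + of_bool (i < n) + of_bool (1 < i)))"
    unfolding sum_distrib_left[of 2] using c by (intro sum.cong block_same) auto
  finally show ?thesis
    by (simp add: pg_schultz_def schultz_def)
qed

text \<open>Absorbing \<open>d\<^sub>i\<close> (or \<open>d\<^sub>j\<close>) into the gap turns \<open>gap i j\<close> into \<open>gap (i-1) j\<close> (or \<open>gap i (j+1)\<close>),
  so the degree corrections telescope into the same sum as the main term.\<close>

lemma sum_blocks_left:
  assumes "2 \<le> j"
  shows "(\<Sum>i=1..<j. of_bool (1 < i) * (6 + 5 * gap c i j + 5 * cyc_dist 0 (c i))) + 6
    = (\<Sum>i=1..<j. 1 + 5 * gap c i j)"
proof -
  obtain m where j: "j = Suc (Suc m)"
    using assms by (auto simp: le_iff_add)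
  have "(\<Sum>i=1..<j. of_bool (1 < i) * (6 + 5 * gap c i j + 5 * cyc_dist 0 (c i)))
      = (\<Sum>i=Suc 1..<Suc (Suc m). of_bool (1 < i) * (6 + 5 * gap c i j + 5 * cyc_dist 0 (c i)))"
    unfolding j by (subst sum.atLeast_Suc_lessThan) auto
  also have "\<dots> = (\<Sum>i=1..<Suc m. 6 + 5 * gap c (Suc i) j + 5 * cyc_dist 0 (c (Suc i)))"
    unfolding sum.shift_bounds_Suc_ivl by simp
  \<comment> \<open>After the shift only the index \<open>i = j - 1\<close> is missing; its term is
    \<open>1 + 5 * 1 = 6\<close>.\<close>
  also have "\<dots> = (\<Sum>i=1..<Suc m. 1 + 5 * gap c i j)"
    by (intro sum.cong refl) (simp add: j gap_extend_left)
  finally show ?thesis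
    by (simp add: j)
qed

text \<open>Shifting \<open>j\<close> to \<open>j + 1\<close> leaves out exactly the
  \<open>m\<close> adjacent pairs, each of value 6.\<close>

lemma sum_blocks_right:
  "(\<Sum>j=1..Suc m. \<Sum>i=1..<j. of_bool (j < Suc m) * (6 + 5 * gap c i j + 5 * cyc_dist 0 (c j))) + 6 * m
    = (\<Sum>j=1..Suc m. \<Sum>i=1..<j. 1 + 5 * gap c i j)"
proof -
  have "(\<Sum>j=1..Suc m. \<Sum>i=1..<j. of_bool (j < Suc m) * (6 + 5 * gap c i j + 5 * cyc_dist 0 (c j)))
      = (\<Sum>j=1..m. \<Sum>i=1..<j. 6 + 5 * gap c i j + 5 * cyc_dist 0 (c j))"
    by simp
  also have "\<dots> + 6 * m = (\<Sum>j=1..Suc m. \<Sum>i=1..<j. 1 + 5 * gap c i j)"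
  proof (induction m)
    case (Suc m)
    have "(\<Sum>i=1..<Suc m. 6 + 5 * gap c i (Suc m) + 5 * cyc_dist 0 (c (Suc m)))
        = (\<Sum>i=1..<Suc m. 1 + 5 * gap c i (Suc (Suc m)))"
      by (intro sum.cong refl) (simp add: gap_extend_right)
    with Suc show ?case
      by simp
  qed simp
  finally show ?thesis .
qed

text \<open>Each correction turns into \<open>1 + 5 * gap c i j\<close>, so 252 and 110 become 254
  and 120. The deficit \<open>12 * (n - 1)\<close> later cancels the degree surplus of the bridge
  ends in the diagonal blocks.\<close>

lemma sum_blocks:
  assumes c: "\<And>i. 1 \<le> i \<Longrightarrow> i < n \<Longrightarrow> c i < 5" and n: "1 \<le> n"
  shows "(\<Sum>j=1..n. \<Sum>i=1..<j. block c n i j) + 12 * (n - 1)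
    = (\<Sum>j=1..n. \<Sum>i=1..<j. 254 + 120 * gap c i j)"
proof -
  obtain m where m: "n = Suc m"
    using n by (cases n) auto
  let ?L = "\<lambda>i j. of_bool (1 < i) * (6 + 5 * gap c i j + 5 * cyc_dist 0 (c i))"
  let ?R = "\<lambda>i j. of_bool (j < n) * (6 + 5 * gap c i j + 5 * cyc_dist 0 (c j))"
  define G H where "G j = (\<Sum>i=1..<j. ?L i j)" and "H j = (\<Sum>i=1..<j. 1 + 5 * gap c i j)" for j
  have GH: "G j + 6 = H j" if "2 \<le> j" for j
    unfolding G_def H_def by (rule sum_blocks_left) fact
  \<comment> \<open>Column \<open>j = 1\<close> is empty on both sides, so only \<open>k\<close> of
    the \<open>k + 1\<close> columns carry a 6.\<close>
  have "(\<Sum>j=1..Suc k. G j) + 6 * k = (\<Sum>j=1..Suc k. H j)" for k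
  proof (induction k)
    case (Suc k)
    then show ?case
      using GH[of "Suc (Suc k)"] by simp
  qed (simp add: G_def H_def)
  note L = this[of m, unfolded G_def H_def]
  have add2: "a + x + y + 12 * k = a + s + s"
    if "x + 6 * k = s" "y + 6 * k = s" for a x y s k :: nat
    using that by linarith
  have blocks: "(\<Sum>j=1..n. \<Sum>i=1..<j. block c n i j)
      = (\<Sum>j=1..n. \<Sum>i=1..<j. 252 + 110 * gap c i j + ?L i j + ?R i j)"
    using c by (intro sum.cong refl block_less) auto
  have "(\<Sum>j=1..n. \<Sum>i=1..<j. block c n i j) + 12 * (n - 1)
      = (\<Sum>j=1..n. \<Sum>i=1..<j. 252 + 110 * gap c i j)
        + (\<Sum>j=1..n. \<Sum>i=1..<j. ?L i j) + (\<Sum>j=1..n. \<Sum>i=1..<j. ?R i j) + 12 * (n - 1)"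
    unfolding blocks by (simp only: sum.distrib)
  also have "\<dots> = (\<Sum>j=1..n. \<Sum>i=1..<j. 252 + 110 * gap c i j)
      + (\<Sum>j=1..n. \<Sum>i=1..<j. 1 + 5 * gap c i j) + (\<Sum>j=1..n. \<Sum>i=1..<j. 1 + 5 * gap c i j)"
    unfolding m diff_Suc_1 by (rule add2[OF L sum_blocks_right])
  also have "\<dots> = (\<Sum>j=1..n. \<Sum>i=1..<j. (252 + 110 * gap c i j) + (1 + 5 * gap c i j)
      + (1 + 5 * gap c i j))"
    by (simp only: sum.distrib)
  also have "\<dots> = (\<Sum>j=1..n. \<Sum>i=1..<j. 254 + 120 * gap c i j)"
    by (intro sum.cong refl) simp
  finally show ?thesis .
qed

lemma sum_gap_column:
  "(\<Sum>i=1..<Suc n. real (gap c i (Suc n)))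
    = real n * (real n + 1) / 2 + (\<Sum>k=1..n. (real k - 1) * real (cyc_dist 0 (c k)))"
proof (induction n)
  case (Suc n)
  have "(\<Sum>i=1..<Suc (Suc n). real (gap c i (Suc (Suc n))))
      = (\<Sum>i=1..<Suc n. real (gap c i (Suc n)) + (real (cyc_dist 0 (c (Suc n))) + 1)) + 1"
    by (simp add: gap_extend_right)
  also have "\<dots> = (\<Sum>i=1..<Suc n. real (gap c i (Suc n))) + real n * (real (cyc_dist 0 (c (Suc n))) + 1) + 1"
    by (simp only: sum.distrib sum_constant) (simp add: algebra_simps)
  finally show ?case
    unfolding Suc by (simp add: field_simps)
qed simp

text \<open>Pentagon \<open>k\<close> is traversed by the pairs \<open>i < k < j\<close>, and there
  are \<open>(k - 1) * (n - k)\<close> of them. The bridges alone contribute the sum of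
  \<open>j - i\<close>, which is the cubic term.\<close>

lemma sum_gap:
  "(\<Sum>j=1..n. \<Sum>i=1..<j. real (gap c i j))
    = (real n ^ 3 - real n) / 6 + (\<Sum>k=1..n. (real k - 1) * (real n - real k) * real (cyc_dist 0 (c k)))"
proof (induction n)
  case (Suc n)
  have "(\<Sum>k=1..Suc n. (real k - 1) * (real (Suc n) - real k) * real (cyc_dist 0 (c k)))
      = (\<Sum>k=1..n. (real k - 1) * (real n - real k) * real (cyc_dist 0 (c k)))
        + (\<Sum>k=1..n. (real k - 1) * real (cyc_dist 0 (c k)))"
    by (simp add: algebra_simps flip: sum.distrib)
  with Suc sum_gap_column[of c n] show ?case
    by (simp add: field_simps power3_eq_cube)
qed simp

text \<open>The polynomial collects \<open>60 * n\<close> from the single pentagons, 254 for each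
  pair, and 120 times the bridge count \<open>(n ^ 3 - n) / 6\<close>.\<close>

lemma pg_schultz_eq:
  assumes c: "\<And>i. 1 \<le> i \<Longrightarrow> i < n \<Longrightarrow> c i < 5" and n: "1 \<le> n"
  shows "real (pg_schultz n c) = 20 * real n ^ 3 + 127 * real n ^ 2 - 87 * real n
    + 120 * (\<Sum>k=1..n. (real k - 1) * (real n - real k) * real (cyc_dist 0 (c k)))"
proof -
  have deg: "(\<Sum>i=1..n. 6 * (10 + of_bool (i < n) + of_bool (1 < i))) + 12 = 72 * n"
  proof -
    have 1: "(\<Sum>i=1..n. of_bool (i < n)) + 1 = n"
      using n by (cases n) auto
    have 2: "(\<Sum>i=1..n. of_bool (1 < i)) + 1 = n"
    proof -
      have "(\<Sum>i=1..Suc m. of_bool (1 < i)) = m" for m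
        by (induction m) auto
      with n show ?thesis by (cases n) auto
    qed
    show ?thesis
      using 1 2 by (simp add: sum.distrib flip: sum_distrib_left)
  qed
  have const: "(\<Sum>j=1..n. \<Sum>i=1..<j. 254 :: real) = 127 * (real n ^ 2 - real n)" for n :: nat
    by (induction n) (auto simp: power2_eq_square algebra_simps)
  have "real (\<Sum>j=1..n. \<Sum>i=1..<j. 254 + 120 * gap c i j)
      = (\<Sum>j=1..n. \<Sum>i=1..<j. 254) + 120 * (\<Sum>j=1..n. \<Sum>i=1..<j. real (gap c i j))"
    by (simp add: sum.distrib sum_distrib_left)
  also have "\<dots> = 127 * (real n ^ 2 - real n) + 20 * (real n ^ 3 - real n)
      + 120 * (\<Sum>k=1..n. (real k - 1) * (real n - real k) * real (cyc_dist 0 (c k)))"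
    unfolding const sum_gap by (simp add: field_simps)
  finally have "real (\<Sum>j=1..n. \<Sum>i=1..<j. block c n i j) + 12 * (real n - 1) = \<dots>"
    using arg_cong[where f = real, OF sum_blocks[OF c n]] n by (simp add: of_nat_diff)
  then show ?thesis
    using arg_cong[where f = real, OF pg_schultz_eq_blocks[OF c]] arg_cong[where f = real, OF deg]
    by simp
qed

section \<open>Uniform central limit theorem for bounded triangular arrays\<close>

text \<open>Polya's theorem: continuity of the limit supplies a finite grid of quantiles, and
  monotonicity interpolates between them.\<close>

lemma weak_conv_m_imp_uniform_cdf:
  assumes M: "\<And>n. real_distribution (M n)" and M': "real_distribution M'"
    and conv: "weak_conv_m M M'" and cont: "\<And>x. isCont (cdf M') x"
  shows "(\<lambda>n. SUP x. \<bar>cdf (M n) x - cdf M' x\<bar>) \<longlonglongrightarrow> 0"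
proof (rule LIMSEQ_I)
  fix r :: real assume r: "0 < r"
  interpret M: real_distribution "M n" for n by (rule M)
  interpret M': real_distribution M' by (rule M')
  \<comment> \<open>Both distribution functions are monotone, so it suffices to control them at the quantiles \<open>j / N\<close>.\<close>
  define F where "F = cdf M'"
  \<comment> \<open>The mesh \<open>1 / N\<close> costs less than \<open>r / 2\<close> and pointwise
    convergence at the grid costs \<open>r / 4\<close>; the total \<open>3 * r / 4\<close> stays
    strictly below \<open>r\<close> after taking the supremum.\<close>
  obtain N :: nat where N: "2 / r < real N"
    using reals_Archimedean2 by blast
  have N0: "0 < N"
    using N r by (intro gr0I) (auto simp: field_simps)
  with N r have N1: "1 / real N < r / 2"
    by (simp add: field_simps)
  \<comment> \<open>Only interior levels are used, since the values 0 and 1 need not be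
    attained.\<close>
  have quantile: "\<exists>x. F x = real j / real N" if j: "0 < j" "j < N" for j
  proof -
    have "eventually (\<lambda>x. F x < real j / real N) at_bot"
      unfolding F_def using j by (intro order_tendstoD(2)[OF M'.cdf_lim_at_bot]) simp
    then obtain a where a: "F a < real j / real N"
      by (auto simp: eventually_at_bot_linorder)
    have "eventually (\<lambda>x. real j / real N < F x) at_top"
      unfolding F_def using j by (intro order_tendstoD(1)[OF M'.cdf_lim_at_top_prob]) simp
    then obtain b where b: "real j / real N < F b"
      by (auto simp: eventually_at_top_linorder)
    have "a \<le> b"
      using a b M'.cdf_nondecreasing[of b a] unfolding F_def by linarith
    then show ?thesis
      using IVT[of F a "real j / real N" b] a b cont unfolding F_def by auto
  qed
  define x where "x j = (SOME x. F x = real j / real N)" for j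
  have x: "F (x j) = real j / real N" if "0 < j" "j < N" for j
    unfolding x_def using quantile[OF that] by (rule someI_ex)
  have "eventually (\<lambda>n. \<forall>j\<in>{0<..<N}. \<bar>cdf (M n) (x j) - F (x j)\<bar> < r / 4) sequentially"
  proof (rule eventually_ball_finite, simp, intro ballI)
    fix j
    have "(\<lambda>n. cdf (M n) (x j)) \<longlonglongrightarrow> F (x j)"
      using conv cont unfolding weak_conv_m_def weak_conv_def F_def by blast
    from tendstoD[OF this, of "r / 4"] r
    show "eventually (\<lambda>n. \<bar>cdf (M n) (x j) - F (x j)\<bar> < r / 4) sequentially"
      by (simp add: dist_real_def)
  qed
  then obtain n0 where "\<forall>n\<ge>n0. \<forall>j\<in>{0<..<N}. \<bar>cdf (M n) (x j) - F (x j)\<bar> < r / 4"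
    unfolding eventually_sequentially by blast
  then have n0: "\<bar>cdf (M n) (x j) - F (x j)\<bar> < r / 4" if "n \<ge> n0" "0 < j" "j < N" for n j
    using that by simp
  have bound: "\<bar>cdf (M n) a - F a\<bar> \<le> 3 * r / 4" if n: "n \<ge> n0" for n a
  proof -
    have F01: "0 \<le> F a" "F a \<le> 1" "0 \<le> cdf (M n) a" "cdf (M n) a \<le> 1"
      unfolding F_def by (auto simp: M'.cdf_nonneg M.cdf_nonneg M'.cdf_bounded_prob M.cdf_bounded_prob)
    have upper: "cdf (M n) a \<le> F a + 3 * r / 4"
    proof (cases "1 \<le> F a + 1 / real N")
      case True
      with F01 N1 r show ?thesis by linarith
    next
      case False
      \<comment> \<open>The lowest grid level strictly above \<open>F a\<close>. Strictness forces
        \<open>a \<le> x j\<close> although \<open>F\<close> need not be injective.\<close>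
      define j where "j = nat \<lfloor>F a * real N\<rfloor> + 1"
      have "0 \<le> \<lfloor>F a * real N\<rfloor>"
        using F01 by simp
      then have "real j = real_of_int \<lfloor>F a * real N\<rfloor> + 1"
        by (simp add: j_def)
      then have j: "F a * real N < real j" "real j \<le> F a * real N + 1"
        using floor_correct[of "F a * real N"] by linarith+
      from False N0 have "F a * real N + 1 < real N"
        by (simp add: field_simps)
      with j have "real j < real N"
        by linarith
      then have jN: "0 < j" "j < N"
        by (auto simp: j_def)
      have "F a < real j / real N" and Fj: "real j / real N \<le> F a + 1 / real N"
        using j N0 by (auto simp: field_simps)
      then have "F a < F (x j)"
        using x[OF jN] by simp
      then have "a \<le> x j"
        using M'.cdf_nondecreasing[of "x j" a] unfolding F_def by linarith
      then have "cdf (M n) a \<le> cdf (M n) (x j)"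
        by (rule M.cdf_nondecreasing)
      with n0[OF n jN] x[OF jN] Fj N1 show ?thesis
        by linarith
    qed
    have lower: "F a - 3 * r / 4 \<le> cdf (M n) a"
    proof (cases "F a \<le> 1 / real N")
      case True
      with F01 N1 r show ?thesis by linarith
    next
      case False
      \<comment> \<open>The highest grid level strictly below \<open>F a\<close>, used in the same
        way.\<close>
      define j where "j = nat (\<lceil>F a * real N\<rceil> - 1)"
      from False N0 have gt: "1 < F a * real N"
        by (simp add: field_simps)
      then have "1 \<le> \<lceil>F a * real N\<rceil>"
        by linarith
      then have "real j = real_of_int \<lceil>F a * real N\<rceil> - 1"
        by (simp add: j_def)
      then have j: "real j < F a * real N" "F a * real N \<le> real j + 1"
        using ceiling_correct[of "F a * real N"] by linarith+
      have "F a * real N \<le> 1 * real N"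
        using F01 by (intro mult_right_mono) auto
      with j gt have "0 < real j" "real j < real N"
        by linarith+
      then have jN: "0 < j" "j < N"
        by simp_all
      have "real j / real N < F a" and "F a \<le> (real j + 1) / real N"
        using j N0 by (simp_all add: divide_less_eq le_divide_eq)
      then have "real j / real N < F a" and Fj: "F a \<le> real j / real N + 1 / real N"
        by (simp_all add: add_divide_distrib)
      then have "F (x j) < F a"
        using x[OF jN] by simp
      then have "x j \<le> a"
        using M'.cdf_nondecreasing[of a "x j"] unfolding F_def by linarith
      then have "cdf (M n) (x j) \<le> cdf (M n) a"
        by (rule M.cdf_nondecreasing)
      with n0[OF n jN] x[OF jN] Fj N1 show ?thesis
        by linarith
    qed
    from upper lower show ?thesis by linarith
  qed
  have "norm ((SUP a. \<bar>cdf (M n) a - cdf M' a\<bar>) - 0) < r" if n: "n \<ge> n0" for n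
  proof -
    have le: "(SUP a. \<bar>cdf (M n) a - cdf M' a\<bar>) \<le> 3 * r / 4"
      using bound[OF n] unfolding F_def by (intro cSUP_least) auto
    \<comment> \<open>Boundedness lets the supremum dominate its value at 0, so it is nonnegative
      and its norm is itself.\<close>
    have "bdd_above (range (\<lambda>a. \<bar>cdf (M n) a - cdf M' a\<bar>))"
      using bound[OF n] unfolding F_def by (intro bdd_aboveI[where M = "3 * r / 4"]) auto
    then have "\<bar>cdf (M n) 0 - cdf M' 0\<bar> \<le> (SUP a. \<bar>cdf (M n) a - cdf M' a\<bar>)"
      by (intro cSUP_upper) auto
    with le r show ?thesis by simp
  qed
  then show "\<exists>n0. \<forall>n\<ge>n0. norm ((SUP a. \<bar>cdf (M n) a - cdf M' a\<bar>) - 0) < r"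
    by blast
qed

text \<open>The sandwich \<open>1 - x \<le> exp (- x) \<le> 1 / (1 + x)\<close> leaves an error of
  at most \<open>x\<^sup>2 / (1 + x)\<close>.\<close>

lemma abs_exp_minus_taylor1: "0 \<le> x \<Longrightarrow> \<bar>exp (- x) - (1 - x)\<bar> \<le> x\<^sup>2" for x :: real
proof -
  assume x: "0 \<le> x"
  have "exp (- x) \<le> 1 / (1 + x)"
    using x exp_ge_add_one_self[of x] by (simp add: exp_minus field_simps)
  also have "1 / (1 + x) - (1 - x) = x\<^sup>2 / (1 + x)"
    using x by (simp add: field_simps power2_eq_square)
  then have "1 / (1 + x) = (1 - x) + x\<^sup>2 / (1 + x)"
    by simp
  also have "x\<^sup>2 / (1 + x) \<le> x\<^sup>2"
    using x by (simp add: divide_le_eq mult_le_cancel_left1)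
  finally show ?thesis
    using exp_ge_add_one_self[of "- x"] by auto
qed

section \<open>Characteristic functions and sums of independent variables\<close>

context prob_space
begin

text \<open>Both functions are compared with \<open>1 - t\<^sup>2 * v / 2\<close>. The error is kept
  proportional to the variance so that it can be summed over an array of total variance 1.\<close>

lemma char_gaussian_approx:
  fixes X :: "'a \<Rightarrow> real"
  assumes X: "random_variable borel X" and mean: "expectation X = 0"
    and bound: "\<And>\<omega>. \<omega> \<in> space M \<Longrightarrow> \<bar>X \<omega>\<bar> \<le> b"
  shows "cmod (char (distr M borel X) t - exp (- (t\<^sup>2 * variance X / 2)))
    \<le> (\<bar>t\<bar> ^ 3 * b + t ^ 4 * b\<^sup>2) * variance X"
proof -
  note [measurable] = X
  obtain \<omega>0 where "\<omega>0 \<in> space M"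
    using not_empty by blast
  then have b: "0 \<le> b"
    using bound[of \<omega>0] by simp
  have sq: "(X \<omega>)\<^sup>2 \<le> b\<^sup>2" if "\<omega> \<in> space M" for \<omega>
    using bound[OF that] by (simp add: abs_le_square_iff[symmetric])
  have intX: "integrable M X"
    using bound by (intro integrable_const_bound[where B = b]) auto
  have intX2: "integrable M (\<lambda>\<omega>. (X \<omega>)\<^sup>2)"
    using sq by (intro integrable_const_bound[where B = "b\<^sup>2"]) auto
  define v where "v = variance X"
  have v_eq: "v = expectation (\<lambda>\<omega>. (X \<omega>)\<^sup>2)"
    by (simp add: v_def mean)
  have v: "0 \<le> v" "v \<le> b\<^sup>2"
    unfolding v_eq using sq intX2 by (auto intro!: integral_le_const)
  \<comment> \<open>The cubic branch of the minimum in \<open>char_approx3'\<close> suffices, since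
    a variable bounded by \<open>b\<close> has its third absolute power below \<open>b\<close> times
    its square.\<close>
  have "expectation (\<lambda>\<omega>. min (6 * (X \<omega>)\<^sup>2) (\<bar>t\<bar> * \<bar>X \<omega>\<bar> ^ 3)) \<le> expectation (\<lambda>\<omega>. \<bar>t\<bar> * b * (X \<omega>)\<^sup>2)"
  proof (rule integral_mono)
    show "integrable M (\<lambda>\<omega>. min (6 * (X \<omega>)\<^sup>2) (\<bar>t\<bar> * \<bar>X \<omega>\<bar> ^ 3))"
      by (rule Bochner_Integration.integrable_bound[where f = "\<lambda>\<omega>. 6 * (X \<omega>)\<^sup>2"]) (use intX2 in auto)
    show "integrable M (\<lambda>\<omega>. \<bar>t\<bar> * b * (X \<omega>)\<^sup>2)"
      using intX2 by simp
    fix \<omega> assume "\<omega> \<in> space M"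
    then have "\<bar>X \<omega>\<bar> * \<bar>X \<omega>\<bar>\<^sup>2 \<le> b * \<bar>X \<omega>\<bar>\<^sup>2"
      using bound by (intro mult_right_mono) auto
    then have "\<bar>t\<bar> * \<bar>X \<omega>\<bar> ^ 3 \<le> \<bar>t\<bar> * b * (X \<omega>)\<^sup>2"
      unfolding mult.assoc by (intro mult_left_mono) (auto simp: power3_eq_cube power2_eq_square)
    then show "min (6 * (X \<omega>)\<^sup>2) (\<bar>t\<bar> * \<bar>X \<omega>\<bar> ^ 3) \<le> \<bar>t\<bar> * b * (X \<omega>)\<^sup>2"
      by linarith
  qed
  also have "\<dots> = \<bar>t\<bar> * b * v"
    using intX2 by (simp add: v_eq)
  finally have "t\<^sup>2 / 6 * expectation (\<lambda>\<omega>. min (6 * (X \<omega>)\<^sup>2) (\<bar>t\<bar> * \<bar>X \<omega>\<bar> ^ 3))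
      \<le> t\<^sup>2 / 6 * (\<bar>t\<bar> * b * v)"
    by (intro mult_left_mono) auto
  also have "\<dots> = (\<bar>t\<bar> ^ 3 * b * v) / 6"
    by (simp add: power3_eq_cube power2_eq_square)
  also have "\<dots> \<le> \<bar>t\<bar> ^ 3 * b * v"
    using b v by simp
  finally have 1: "cmod (char (distr M borel X) t - (1 - t\<^sup>2 * v / 2)) \<le> \<bar>t\<bar> ^ 3 * b * v"
    using char_approx3'[OF X intX intX2 mean v_def[symmetric] refl, of t] by simp
  have "\<bar>exp (- (t\<^sup>2 * v / 2)) - (1 - t\<^sup>2 * v / 2)\<bar> \<le> (t\<^sup>2 * v / 2)\<^sup>2"
    using v by (intro abs_exp_minus_taylor1) simp
  also have "\<dots> = t ^ 4 * (v * v) / 4"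
    by (simp add: power2_eq_square eval_nat_numeral)
  also have "\<dots> \<le> t ^ 4 * (v * v)"
    using v by simp
  \<comment> \<open>One factor \<open>v\<close> is replaced by its bound \<open>b\<^sup>2\<close>;
    the other stays for the summation.\<close>
  also have "\<dots> \<le> t ^ 4 * (b\<^sup>2 * v)"
    using v by (intro mult_left_mono mult_right_mono) auto
  finally have "cmod (complex_of_real (1 - t\<^sup>2 * v / 2) - complex_of_real (exp (- (t\<^sup>2 * v / 2)))) \<le> t ^ 4 * (b\<^sup>2 * v)"
    unfolding of_real_diff[symmetric] norm_of_real by (simp add: abs_minus_commute)
  with 1 have "cmod (char (distr M borel X) t - exp (- (t\<^sup>2 * v / 2))) \<le> \<bar>t\<bar> ^ 3 * b * v + t ^ 4 * (b\<^sup>2 * v)"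
    by (intro norm_diff_triangle_le[where y = "complex_of_real (1 - t\<^sup>2 * v / 2)"])
       (simp_all add: exp_of_real)
  then show ?thesis
    unfolding v_def[symmetric] by (simp add: algebra_simps)
qed

text \<open>A vanishing uniform bound \<open>b n\<close> takes the place of Lindeberg's condition. A
  difference of products of factors in the unit disc is at most the sum of the factor differences,
  and Levy's continuity theorem concludes. Unit variance is asked only eventually, since the first
  rows may be degenerate.\<close>

theorem central_limit_theorem_bounded_array:
  fixes X :: "nat \<Rightarrow> 'i \<Rightarrow> 'a \<Rightarrow> real"
  assumes fin: "\<And>n. finite (I n)"
    and indep: "\<And>n. indep_vars (\<lambda>_. borel) (X n) (I n)"
    and mean: "\<And>n i. i \<in> I n \<Longrightarrow> expectation (X n i) = 0"
    and bound: "\<And>n i \<omega>. i \<in> I n \<Longrightarrow> \<omega> \<in> space M \<Longrightarrow> \<bar>X n i \<omega>\<bar> \<le> b n"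
    and b: "b \<longlonglongrightarrow> 0"
    and var: "eventually (\<lambda>n. (\<Sum>i\<in>I n. variance (X n i)) = 1) sequentially"
  shows "weak_conv_m (\<lambda>n. distr M borel (\<lambda>\<omega>. \<Sum>i\<in>I n. X n i \<omega>)) std_normal_distribution"
proof (rule levy_continuity)
  have rv: "random_variable borel (X n i)" if "i \<in> I n" for n i
    using indep[of n] that unfolding indep_vars_def2 by blast
  show "real_distribution (distr M borel (\<lambda>\<omega>. \<Sum>i\<in>I n. X n i \<omega>))" for n
    using rv by (intro real_distribution_distr borel_measurable_sum) auto
  show "real_distribution std_normal_distribution"
    by (rule real_dist_normal_dist)
  fix t :: real
  have le: "eventually (\<lambda>n. cmod (char (distr M borel (\<lambda>\<omega>. \<Sum>i\<in>I n. X n i \<omega>)) t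
      - char std_normal_distribution t) \<le> \<bar>t\<bar> ^ 3 * b n + t ^ 4 * (b n)\<^sup>2) sequentially"
    using var
  proof eventually_elim
    case (elim n)
    let ?g = "\<lambda>i. complex_of_real (exp (- (t\<^sup>2 * variance (X n i) / 2)))"
    have "exp (- (t\<^sup>2) / 2) = exp (\<Sum>i\<in>I n. - (t\<^sup>2 * variance (X n i) / 2))"
      using elim by (simp add: sum_negf flip: sum_divide_distrib sum_distrib_left)
    also have "\<dots> = (\<Prod>i\<in>I n. exp (- (t\<^sup>2 * variance (X n i) / 2)))"
      using fin by (rule exp_sum)
    finally have "char std_normal_distribution t = (\<Prod>i\<in>I n. ?g i)"
      unfolding char_std_normal_distribution of_real_prod[symmetric] by simp
    then have "cmod (char (distr M borel (\<lambda>\<omega>. \<Sum>i\<in>I n. X n i \<omega>)) t - char std_normal_distribution t)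
        = cmod ((\<Prod>i\<in>I n. char (distr M borel (X n i)) t) - (\<Prod>i\<in>I n. ?g i))"
      using char_distr_sum[OF indep] by simp
    also have "\<dots> \<le> (\<Sum>i\<in>I n. cmod (char (distr M borel (X n i)) t - ?g i))"
    proof (rule norm_prod_diff)
      fix i assume i: "i \<in> I n"
      interpret D: real_distribution "distr M borel (X n i)"
        using rv[OF i] by (rule real_distribution_distr)
      show "cmod (char (distr M borel (X n i)) t) \<le> 1"
        by (rule D.cmod_char_le_1)
      show "cmod (?g i) \<le> 1"
        by (simp only: norm_of_real) simp
    qed
    also have "\<dots> \<le> (\<Sum>i\<in>I n. (\<bar>t\<bar> ^ 3 * b n + t ^ 4 * (b n)\<^sup>2) * variance (X n i))"
    proof (rule sum_mono)
      fix i assume i: "i \<in> I n"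
      show "cmod (char (distr M borel (X n i)) t - ?g i)
          \<le> (\<bar>t\<bar> ^ 3 * b n + t ^ 4 * (b n)\<^sup>2) * variance (X n i)"
        using char_gaussian_approx[OF rv[OF i] mean[OF i] bound[OF i], of t]
        by (simp add: exp_of_real)
    qed
    also have "\<dots> = \<bar>t\<bar> ^ 3 * b n + t ^ 4 * (b n)\<^sup>2"
      using elim by (simp flip: sum_distrib_left)
    finally show ?case .
  qed
  have "(\<lambda>n. \<bar>t\<bar> ^ 3 * b n + t ^ 4 * (b n)\<^sup>2) \<longlonglongrightarrow> \<bar>t\<bar> ^ 3 * 0 + t ^ 4 * 0\<^sup>2"
    by (intro tendsto_intros b)
  then have lim: "(\<lambda>n. \<bar>t\<bar> ^ 3 * b n + t ^ 4 * (b n)\<^sup>2) \<longlonglongrightarrow> 0"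
    by simp
  have "(\<lambda>n. char (distr M borel (\<lambda>\<omega>. \<Sum>i\<in>I n. X n i \<omega>)) t
      - char std_normal_distribution t) \<longlonglongrightarrow> 0"
    by (rule Lim_null_comparison[OF le lim])
  then show "(\<lambda>n. char (distr M borel (\<lambda>\<omega>. \<Sum>i\<in>I n. X n i \<omega>)) t) \<longlonglongrightarrow> char std_normal_distribution t"
    by (rule LIM_zero_cancel)
qed

text \<open>Cross terms vanish because independence factorises their expectation and the means are
  0. Integrability goes through the same induction, as linearity of the expectation relies on
  it.\<close>

lemma expectation_square_sum_indep:
  fixes X :: "'i \<Rightarrow> 'a \<Rightarrow> real"
  assumes "finite I" and "indep_vars (\<lambda>_. borel) X I"
    and "\<And>i. i \<in> I \<Longrightarrow> expectation (X i) = 0"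
    and "\<And>i. i \<in> I \<Longrightarrow> integrable M (\<lambda>\<omega>. (X i \<omega>)\<^sup>2)"
  shows "integrable M (\<lambda>\<omega>. (\<Sum>i\<in>I. X i \<omega>)\<^sup>2)"
    and "expectation (\<lambda>\<omega>. (\<Sum>i\<in>I. X i \<omega>)\<^sup>2) = (\<Sum>i\<in>I. expectation (\<lambda>\<omega>. (X i \<omega>)\<^sup>2))"
proof -
  have "integrable M (\<lambda>\<omega>. (\<Sum>i\<in>I. X i \<omega>)\<^sup>2) \<and>
    expectation (\<lambda>\<omega>. (\<Sum>i\<in>I. X i \<omega>)\<^sup>2) = (\<Sum>i\<in>I. expectation (\<lambda>\<omega>. (X i \<omega>)\<^sup>2))"
    using assms
  proof (induction I rule: finite_induct)
    case (insert j I)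
    have rv: "random_variable borel (X i)" if "i \<in> insert j I" for i
      using insert.prems(1) that unfolding indep_vars_def2 by blast
    have int: "integrable M (X i)" if "i \<in> insert j I" for i
      using rv[OF that] insert.prems(3)[OF that] by (rule square_integrable_imp_integrable)
    have intS: "integrable M (\<lambda>\<omega>. \<Sum>i\<in>I. X i \<omega>)"
      using int by (intro Bochner_Integration.integrable_sum) auto
    have IH: "integrable M (\<lambda>\<omega>. (\<Sum>i\<in>I. X i \<omega>)\<^sup>2)"
      "expectation (\<lambda>\<omega>. (\<Sum>i\<in>I. X i \<omega>)\<^sup>2) = (\<Sum>i\<in>I. expectation (\<lambda>\<omega>. (X i \<omega>)\<^sup>2))"
      using insert.IH insert.prems indep_vars_subset[OF insert.prems(1)] by auto
    have ind: "indep_var borel (X j) borel (\<lambda>\<omega>. \<Sum>i\<in>I. X i \<omega>)"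
      using insert by (intro indep_vars_sum) auto
    have cross: "integrable M (\<lambda>\<omega>. X j \<omega> * (\<Sum>i\<in>I. X i \<omega>))"
      "expectation (\<lambda>\<omega>. X j \<omega> * (\<Sum>i\<in>I. X i \<omega>)) = 0"
      using indep_var_integrable[OF ind _ intS] indep_var_lebesgue_integral[OF ind _ intS] int
        insert.prems(2)[of j] by auto
    have eq: "(\<Sum>i\<in>insert j I. X i \<omega>)\<^sup>2
        = (X j \<omega>)\<^sup>2 + (\<Sum>i\<in>I. X i \<omega>)\<^sup>2 + 2 * (X j \<omega> * (\<Sum>i\<in>I. X i \<omega>))" for \<omega>
      using insert.hyps by (simp add: power2_sum)
    show ?case
      unfolding eq using insert.hyps insert.prems(3)[of j] IH cross by simp
  qed simp
  then show "integrable M (\<lambda>\<omega>. (\<Sum>i\<in>I. X i \<omega>)\<^sup>2)"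
    and "expectation (\<lambda>\<omega>. (\<Sum>i\<in>I. X i \<omega>)\<^sup>2) = (\<Sum>i\<in>I. expectation (\<lambda>\<omega>. (X i \<omega>)\<^sup>2))"
    by auto
qed

end

section \<open>The standard normal distribution function\<close>

lemma cdf_std_normal_distribution:
  "cdf std_normal_distribution a = (LBINT t:{..a}. exp (- t\<^sup>2 / 2) / sqrt (2 * pi))"
proof -
  interpret real_distribution std_normal_distribution
    by (rule real_dist_normal_dist)
  have "cdf std_normal_distribution a = (LINT t|std_normal_distribution. indicator {..a} t)"
    by (simp add: cdf_def)
  also have "\<dots> = (LBINT t. std_normal_density t * indicator {..a} t)"
    by (subst integral_density) (auto simp: normal_density_nonneg)
  finally show ?thesis
    by (simp add: set_lebesgue_integral_def std_normal_density_def mult.commute)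
qed

lemma isCont_cdf_std_normal_distribution: "isCont (cdf std_normal_distribution) x"
proof -
  interpret real_distribution std_normal_distribution
    by (rule real_dist_normal_dist)
  have "AE t in lborel. t \<noteq> x"
    by (rule AE_lborel_singleton)
  then have "emeasure std_normal_distribution {x} = 0"
    by (subst emeasure_density) (auto intro!: nn_integral_zero' simp: indicator_def)
  then show ?thesis
    by (simp add: isCont_cdf measure_def)
qed

section \<open>Variance and asymptotic normality of the Schultz index\<close>

text \<open>A free \<open>x\<close> decouples the summand from the upper limit, which makes
  induction on \<open>n\<close> possible. The right side is the expansion in powers of
  \<open>x\<close> with the usual power sums.\<close>

lemma sum_weight_squares_aux:
  fixes x :: real
  shows "(\<Sum>k=1..n. ((real k - 1) * (x - real k))\<^sup>2)
    = x\<^sup>2 * ((real n - 1) * real n * (2 * real n - 1) / 6)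
      - 2 * x * (real n ^ 2 * (real n + 1) ^ 2 / 4 - real n * (real n + 1) * (2 * real n + 1) / 3
          + real n * (real n + 1) / 2)
      + (real n * (real n + 1) * (2 * real n + 1) * (3 * real n ^ 2 + 3 * real n - 1) / 30
          - real n ^ 2 * (real n + 1) ^ 2 / 2 + real n * (real n + 1) * (2 * real n + 1) / 6)"
proof (induction n)
  case (Suc n)
  then show ?case
    by (simp add: field_simps power2_eq_square)
qed simp

lemma sum_drop_first:
  fixes f :: "nat \<Rightarrow> 'b::comm_monoid_add"
  assumes "f 1 = 0"
  shows "(\<Sum>k=1..n. f k) = (\<Sum>k=2..n. f k)"
proof (rule sum.mono_neutral_right)
  show "\<forall>k\<in>{1..n} - {2..n}. f k = 0"
  proof
    fix k assume "k \<in> {1..n} - {2..n}"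
    then have "k = 1" by auto
    with assms show "f k = 0" by simp
  qed
qed auto

lemma sum_weight_squares:
  "(\<Sum>k=2..n. ((real k - 1) * (real n - real k))\<^sup>2) = ((real n - 1) ^ 5 - (real n - 1)) / 30"
proof -
  have "(\<Sum>k=2..n. ((real k - 1) * (real n - real k))\<^sup>2) = (\<Sum>k=1..n. ((real k - 1) * (real n - real k))\<^sup>2)"
    by (rule sum_drop_first[symmetric]) simp
  also have "\<dots> = ((real n - 1) ^ 5 - (real n - 1)) / 30"
    unfolding sum_weight_squares_aux by (simp add: field_simps eval_nat_numeral)
  finally show ?thesis .
qed

theorem theorem3p2:
  fixes M :: "'a measure" and c :: "nat \<Rightarrow> 'a \<Rightarrow> nat" and p1 :: real
  assumes P: "prob_space M"
    and meas: "\<And>i. c i \<in> M \<rightarrow>\<^sub>M count_space UNIV"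
    and c1: "\<And>\<omega>. \<omega> \<in> space M \<Longrightarrow> c 1 \<omega> < 5"
    and ci: "\<And>i \<omega>. i \<ge> 2 \<Longrightarrow> \<omega> \<in> space M \<Longrightarrow> c i \<omega> \<in> {1..4}"
    and pz: "\<And>i. i \<ge> 2 \<Longrightarrow> measure M {\<omega> \<in> space M. c i \<omega> \<in> {1, 4}} = p1"
    and ind: "prob_space.indep_vars M (\<lambda>_. count_space UNIV) (\<lambda>i \<omega>. c i \<omega> \<in> {1, 4}) {2..}"
    and p1pos: "0 < p1" and p1lt: "p1 < 1"
  shows
   "(let S = (\<lambda>n \<omega>. real (pg_schultz n (\<lambda>i. c i \<omega>)));
         s2 = 240\<^sup>2 * p1 + 360\<^sup>2 * (1 - p1) - (240 * p1 + 360 * (1 - p1))\<^sup>2;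
         t2 = 113\<^sup>2 * p1 + 233\<^sup>2 * (1 - p1) - (113 * p1 + 233 * (1 - p1))\<^sup>2;
         r2 = 240 * 113 * p1 + 360 * 233 * (1 - p1)
              - (240 * p1 + 360 * (1 - p1)) * (113 * p1 + 233 * (1 - p1))
     in (\<forall>n::nat \<ge> 1.
           prob_space.variance M (S n) =
             (1 / 30) * (s2 * real n ^ 5 - 5 * r2 * real n ^ 4 + 10 * t2 * real n ^ 3
               + (65 * r2 - 30 * s2 - 45 * t2) * real n ^ 2
               + (59 * s2 + 65 * t2 - 120 * r2) * real n
               + (60 * r2 - 30 * s2 - 30 * t2)))
      \<and> (\<lambda>n. SUP a::real. \<bar>measure M {\<omega> \<in> space M.
              (S n \<omega> - prob_space.expectation M (S n)) / sqrt (prob_space.variance M (S n)) \<le> a}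
            - (LBINT t:{..a}. exp (- t\<^sup>2 / 2) / sqrt (2 * pi))\<bar>) \<longlonglongrightarrow> 0)"
proof -
  interpret prob_space M by (rule P)
  define S where "S n \<omega> = real (pg_schultz n (\<lambda>i. c i \<omega>))" for n \<omega>
  define q where "q = p1 * (1 - p1)"
  have q: "0 < q"
    using p1pos p1lt by (simp add: q_def)
  define B :: "nat \<Rightarrow> 'a \<Rightarrow> real" where "B k \<omega> = of_bool (c k \<omega> \<in> {1, 4})" for k \<omega>
  \<comment> \<open>The attachment distance is \<open>2 - B k \<omega>\<close> with mean
    \<open>2 - p1\<close>, so \<open>Z\<close> is its centred version.\<close>
  define Z where "Z k \<omega> = p1 - B k \<omega>" for k \<omega>
  \<comment> \<open>The weight vanishes at \<open>k = 1\<close>, which removes the arbitrary first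
    attachment vertex, and at \<open>k = n\<close>, where no bridge leaves.\<close>
  define w :: "nat \<Rightarrow> nat \<Rightarrow> real" where "w n k = 120 * ((real k - 1) * (real n - real k))" for n k
  define C where "C n = 20 * real n ^ 3 + 127 * real n ^ 2 - 87 * real n + (\<Sum>k=2..n. w n k * (2 - p1))" for n
  define V where "V n = q * (\<Sum>k=2..n. (w n k)\<^sup>2)" for n

  have S_eq: "S n \<omega> = C n + (\<Sum>k=2..n. w n k * Z k \<omega>)" if n: "1 \<le> n" and \<omega>: "\<omega> \<in> space M" for n \<omega>
  proof -
    have lt: "c i \<omega> < 5" if "1 \<le> i" for i
      using ci[of i, OF _ \<omega>] c1[OF \<omega>] that by (cases "i = 1") auto
    have d: "real (cyc_dist 0 (c k \<omega>)) = (2 - p1) + Z k \<omega>" if "2 \<le> k" for k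
    proof -
      have "c k \<omega> \<in> {1, 2, 3, 4}"
        using ci[OF that \<omega>] by auto
      then show ?thesis
        by (auto simp: Z_def B_def cyc_dist_def)
    qed
    have "S n \<omega> = 20 * real n ^ 3 + 127 * real n ^ 2 - 87 * real n
        + (\<Sum>k=1..n. w n k * real (cyc_dist 0 (c k \<omega>)))"
      unfolding S_def using n lt by (subst pg_schultz_eq) (auto simp: w_def sum_distrib_left mult.assoc)
    also have "(\<Sum>k=1..n. w n k * real (cyc_dist 0 (c k \<omega>))) = (\<Sum>k=2..n. w n k * real (cyc_dist 0 (c k \<omega>)))"
      by (rule sum_drop_first) (simp add: w_def)
    also have "\<dots> = (\<Sum>k=2..n. w n k * (2 - p1) + w n k * Z k \<omega>)"
      by (intro sum.cong refl) (simp add: d algebra_simps)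
    finally show ?thesis
      by (simp add: C_def sum.distrib)
  qed

  have Z_rv [measurable]: "random_variable borel (Z k)" for k
    unfolding Z_def B_def
    using measurable_compose[OF meas[of k], of "\<lambda>x. p1 - of_bool (x \<in> {1, 4})" borel] by simp
  have Z_bound: "\<bar>Z k \<omega>\<bar> \<le> 1" for k \<omega>
    using p1pos p1lt by (auto simp: Z_def B_def)
  have Z_int: "integrable M (Z k)" for k
    using Z_bound by (intro integrable_const_bound[where B = 1]) auto
  have B_int: "integrable M (B k)" for k
    using Bochner_Integration.integrable_diff[OF integrable_const[of p1] Z_int[of k]] by (simp add: Z_def)
  have B_mean: "expectation (B k) = p1" if "2 \<le> k" for k
  proof -
    have "expectation (B k) = expectation (indicator {\<omega> \<in> space M. c k \<omega> \<in> {1, 4}})"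
      by (intro Bochner_Integration.integral_cong) (auto simp: B_def indicator_def)
    also have "\<dots> = p1"
      using pz[OF that] by (simp add: Int_absorb2 Collect_restrict del: insert_iff)
    finally show ?thesis .
  qed
  have Z_mean: "expectation (Z k) = 0" if "2 \<le> k" for k
    unfolding Z_def using B_int B_mean[OF that] by (simp add: prob_space)
  have Z_sq: "expectation (\<lambda>\<omega>. (Z k \<omega>)\<^sup>2) = q" if "2 \<le> k" for k
  proof -
    have "(Z k \<omega>)\<^sup>2 = p1\<^sup>2 + (1 - 2 * p1) * B k \<omega>" for \<omega>
      by (cases "c k \<omega> \<in> {1, 4}") (simp_all add: Z_def B_def power2_eq_square algebra_simps)
    then have "expectation (\<lambda>\<omega>. (Z k \<omega>)\<^sup>2) = p1\<^sup>2 + (1 - 2 * p1) * p1"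
      using B_int B_mean[OF that] by (simp add: prob_space)
    then show ?thesis
      by (simp add: q_def power2_eq_square algebra_simps)
  qed
  have Z_sq_int: "integrable M (\<lambda>\<omega>. (Z k \<omega>)\<^sup>2)" for k
    using Z_bound by (intro integrable_const_bound[where B = 1]) (auto simp: abs_square_le_1)
  \<comment> \<open>Each variable is a function of the Boolean
    \<open>c k \<omega> \<in> {1, 4}\<close> alone, so independence of these Booleans carries
    over.\<close>
  have indep: "indep_vars (\<lambda>_. borel) (\<lambda>k \<omega>. a k * Z k \<omega>) {2..n}" for a :: "nat \<Rightarrow> real" and n
    using indep_vars_compose2[OF indep_vars_subset[OF ind], of "{2..n}" "\<lambda>k b. a k * (p1 - of_bool b)" "\<lambda>_. borel"]
    by (auto simp: Z_def B_def)

  have sum_sq: "expectation (\<lambda>\<omega>. (\<Sum>k=2..n. w n k * Z k \<omega>)\<^sup>2) = V n" for n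
  proof -
    have "expectation (\<lambda>\<omega>. (\<Sum>k=2..n. w n k * Z k \<omega>)\<^sup>2) = (\<Sum>k=2..n. expectation (\<lambda>\<omega>. (w n k * Z k \<omega>)\<^sup>2))"
      using indep Z_mean Z_sq_int by (intro expectation_square_sum_indep) (auto simp: power_mult_distrib)
    also have "\<dots> = V n"
      using Z_sq by (simp add: V_def power_mult_distrib sum_distrib_left mult.commute)
    finally show ?thesis .
  qed
  have ES: "expectation (S n) = C n" if "1 \<le> n" for n
  proof -
    have "expectation (S n) = expectation (\<lambda>\<omega>. C n + (\<Sum>k=2..n. w n k * Z k \<omega>))"
      using S_eq[OF that] by (intro Bochner_Integration.integral_cong) auto
    also have "\<dots> = C n"
      using Z_int Z_mean by (simp add: prob_space)
    finally show ?thesis .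
  qed
  have VS: "variance (S n) = V n" if "1 \<le> n" for n
  proof -
    have "variance (S n) = expectation (\<lambda>\<omega>. (\<Sum>k=2..n. w n k * Z k \<omega>)\<^sup>2)"
      using S_eq[OF that] ES[OF that] by (intro Bochner_Integration.integral_cong) auto
    then show ?thesis
      using sum_sq by simp
  qed
  \<comment> \<open>The constant is 480 = 120^2 / 30.\<close>
  have V_eq: "V n = 480 * q * ((real n - 1) ^ 5 - (real n - 1))" for n
  proof -
    have "V n = q * (14400 * (\<Sum>k=2..n. ((real k - 1) * (real n - real k))\<^sup>2))"
      by (simp add: V_def w_def power_mult_distrib sum_distrib_left)
    then show ?thesis
      unfolding sum_weight_squares by (simp add: algebra_simps)
  qed

  \<comment> \<open>For \<open>n \<le> 2\<close> the variance is 0, and division by zero makes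
    \<open>X\<close> and \<open>b\<close> vanish; the bound of \<open>X\<close> by \<open>b\<close>
    thus holds for every \<open>n\<close>.\<close>
  define X where "X n k \<omega> = w n k / sqrt (V n) * Z k \<omega>" for n k \<omega>
  define b where "b n = 120 * (real n)\<^sup>2 / sqrt (V n)" for n
  have V_nonneg: "0 \<le> V n" for n
    using q by (simp add: V_def sum_nonneg)
  have V_pos: "0 < V n" if "3 \<le> n" for n
  proof -
    have "(real n - 1) ^ 1 < (real n - 1) ^ 5"
      using that by (intro power_strict_increasing) auto
    with q that show ?thesis
      by (simp add: V_eq)
  qed
  have "weak_conv_m (\<lambda>n. distr M borel (\<lambda>\<omega>. \<Sum>k\<in>{2..n}. X n k \<omega>)) std_normal_distribution"
  proof (rule central_limit_theorem_bounded_array)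
    show "indep_vars (\<lambda>_. borel) (X n) {2..n}" for n
      unfolding X_def by (rule indep)
    show X_mean: "expectation (X n k) = 0" if "k \<in> {2..n}" for n k
      using Z_mean that by (simp add: X_def[abs_def])
    show "\<bar>X n k \<omega>\<bar> \<le> b n" if "k \<in> {2..n}" for n k \<omega>
    proof -
      have "(real k - 1) * (real n - real k) \<le> real n * real n"
        using that by (intro mult_mono) auto
      moreover have "0 \<le> (real k - 1) * (real n - real k)"
        using that by auto
      ultimately have "\<bar>w n k\<bar> * \<bar>Z k \<omega>\<bar> \<le> 120 * (real n)\<^sup>2 * 1"
        using Z_bound by (intro mult_mono) (auto simp: w_def abs_mult power2_eq_square)
      then have "\<bar>w n k\<bar> * \<bar>Z k \<omega>\<bar> / sqrt (V n) \<le> 120 * (real n)\<^sup>2 * 1 / sqrt (V n)"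
        using V_nonneg by (intro divide_right_mono) auto
      then show ?thesis
        using V_nonneg by (simp add: X_def b_def abs_mult)
    qed
    \<comment> \<open>Weights of order \<open>n ^ 2\<close> against a standard deviation of order
      \<open>n\<close> to the power 5/2.\<close>
    have "(\<lambda>n. 120 * (real n)\<^sup>2 / sqrt (480 * q * ((real n - 1) ^ 5 - (real n - 1)))) \<longlonglongrightarrow> 0"
      using q by real_asymp
    then show "b \<longlonglongrightarrow> 0"
      by (rule Lim_transform_eventually)
         (auto simp: b_def V_eq intro!: eventually_sequentiallyI[of 1])
    show "eventually (\<lambda>n. (\<Sum>k\<in>{2..n}. variance (X n k)) = 1) sequentially"
    proof (rule eventually_sequentiallyI[of 3])
      fix n :: nat assume n: "3 \<le> n"
      have "(\<Sum>k\<in>{2..n}. variance (X n k)) = (\<Sum>k\<in>{2..n}. (w n k)\<^sup>2 / V n * q)"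
      proof (rule sum.cong[OF refl])
        fix k assume k: "k \<in> {2..n}"
        have "variance (X n k) = expectation (\<lambda>\<omega>. (w n k)\<^sup>2 / V n * (Z k \<omega>)\<^sup>2)"
          unfolding X_mean[OF k] using V_nonneg
          by (simp add: X_def power_mult_distrib power_divide)
        also have "\<dots> = (w n k)\<^sup>2 / V n * q"
          using Z_sq k by simp
        finally show "variance (X n k) = (w n k)\<^sup>2 / V n * q" .
      qed
      also have "\<dots> = q * (\<Sum>k=2..n. (w n k)\<^sup>2) / V n"
        by (simp add: sum_distrib_left sum_divide_distrib mult.commute)
      also have "\<dots> = V n / V n"
        by (simp only: V_def)
      finally show "(\<Sum>k\<in>{2..n}. variance (X n k)) = 1"
        using V_pos[OF n] by simp
    qed
  qed simp
  then have lim: "(\<lambda>n. SUP a. \<bar>cdf (distr M borel (\<lambda>\<omega>. \<Sum>k\<in>{2..n}. X n k \<omega>)) a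
      - cdf std_normal_distribution a\<bar>) \<longlonglongrightarrow> 0"
    by (intro weak_conv_m_imp_uniform_cdf isCont_cdf_std_normal_distribution real_dist_normal_dist
        real_distribution_distr) (auto simp: X_def)
  have cdf_eq: "cdf (distr M borel (\<lambda>\<omega>. \<Sum>k\<in>{2..n}. X n k \<omega>)) a
      = prob {\<omega> \<in> space M. (S n \<omega> - expectation (S n)) / sqrt (variance (S n)) \<le> a}" if n: "1 \<le> n" for n a
  proof -
    have "cdf (distr M borel (\<lambda>\<omega>. \<Sum>k\<in>{2..n}. X n k \<omega>)) a
        = prob ((\<lambda>\<omega>. \<Sum>k\<in>{2..n}. X n k \<omega>) -` {..a} \<inter> space M)"
      unfolding cdf_def X_def by (intro measure_distr) auto
    also have "(\<lambda>\<omega>. \<Sum>k\<in>{2..n}. X n k \<omega>) -` {..a} \<inter> space M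
        = {\<omega> \<in> space M. (S n \<omega> - expectation (S n)) / sqrt (variance (S n)) \<le> a}"
      using S_eq[OF n] unfolding ES[OF n] VS[OF n, unfolded ES[OF n]] by (auto simp: X_def sum_divide_distrib)
    finally show ?thesis .
  qed
  have clt: "(\<lambda>n. SUP a. \<bar>prob {\<omega> \<in> space M. (S n \<omega> - expectation (S n)) / sqrt (variance (S n)) \<le> a}
      - (LBINT t:{..a}. exp (- t\<^sup>2 / 2) / sqrt (2 * pi))\<bar>) \<longlonglongrightarrow> 0"
    using lim
    by (rule Lim_transform_eventually)
       (auto simp: cdf_eq cdf_std_normal_distribution intro!: eventually_sequentiallyI[of 1])
  \<comment> \<open>With all three coefficients equal, the polynomial in \<open>n\<close> is the
    expansion of \<open>(n - 1) ^ 5 - (n - 1)\<close>.\<close>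
  have var: "variance (S n) = (1 / 30) * (s2 * real n ^ 5 - 5 * r2 * real n ^ 4 + 10 * t2 * real n ^ 3
        + (65 * r2 - 30 * s2 - 45 * t2) * real n ^ 2 + (59 * s2 + 65 * t2 - 120 * r2) * real n
        + (60 * r2 - 30 * s2 - 30 * t2))"
    if "1 \<le> n" "s2 = 14400 * q" "t2 = 14400 * q" "r2 = 14400 * q" for n s2 t2 r2
    unfolding VS[OF that(1)] V_eq that(2-4)
    by (simp add: algebra_simps eval_nat_numeral)
  \<comment> \<open>Two variances and a covariance of variables on the same two-point space. Both
    pairs of values differ by 120, as 360 - 240 = 233 - 113, so all three equal
    \<open>120\<^sup>2 * q\<close>.\<close>
  have "240\<^sup>2 * p1 + 360\<^sup>2 * (1 - p1) - (240 * p1 + 360 * (1 - p1))\<^sup>2 = 14400 * q"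
    "113\<^sup>2 * p1 + 233\<^sup>2 * (1 - p1) - (113 * p1 + 233 * (1 - p1))\<^sup>2 = 14400 * q"
    "240 * 113 * p1 + 360 * 233 * (1 - p1)
       - (240 * p1 + 360 * (1 - p1)) * (113 * p1 + 233 * (1 - p1)) = 14400 * q"
    by (simp_all add: q_def power2_eq_square algebra_simps)
  note coeffs = this
  show ?thesis
    unfolding Let_def S_def[symmetric] by (intro conjI allI impI var coeffs clt)
qed

end
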